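(* Let $\mathcal{H}$ be a real finite-dimensional Hilbert space, let $I=\{1,\dots,N\}$, and for each $i\in I$ let $f_i\colon\mathcal{H}\to\mathbb{R}$ be convex and differentiable with locally Lipschitz gradient. Let $f(x)=\max_{i\in I} f_i(x)$ and $\phi(x,y)=\sum_{i\in I}y_i f_i(x)$. For $x^*\in\mathcal{H}$, the following conditions are equivalent: (a) $x^*\in\operatorname{argmin} f$; (b) there exists $y^*\in\Delta^N$ such that $\nabla_x\phi(x^*,y^* )=0$ and $f(x^* )=\phi(x^*,y^* )$; (c) there exists $y^*\in\Delta^N$ such that $(x^*,y^* )$ is a saddle point of $\phi$ on $\mathcal{H}\times\Delta^N$. Moreover, for any $y^*\in\Delta^N$ as in (b) or as in (c), $y^*_i>0$ only if $i\in I(x^* )$.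
   Context: $\Delta^N=\{y\in\mathbb{R}^N : y_i\ge 0\ \forall i,\ \sum_{i=1}^N y_i=1\}$ is the probability simplex. A pair $(x^*,y^* )\in\mathcal{H}\times\Delta^N$ is a saddle point of $\phi$ on $\mathcal{H}\times\Delta^N$ if $\phi(x^*,y)\le\phi(x^*,y^* )\le\phi(x,y^* )$ for all $(x,y)\in\mathcal{H}\times\Delta^N$. The active set at $x\in\mathcal{H}$ is $I(x)=\{i\in I : f_i(x)=f(x)\}$. $\nabla_x\phi(x,y)=\sum_{i\in I}y_i\nabla f_i(x)$. *)

theory Defs
  imports "HOL-Analysis.Analysis"
begin

(* The index set {1,...,N} is the universe of a finite type 'n with CARD('n) = N;
   it is nonempty since every type is, so the maximum below is meaningful. *)

definition prob_simplex :: "(real ^ 'n::finite) set" where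
  "prob_simplex = {y. (\<forall>i. 0 \<le> y $ i) \<and> (\<Sum>i\<in>UNIV. y $ i) = 1}"

definition max_fun :: "('n::finite \<Rightarrow> 'a \<Rightarrow> real) \<Rightarrow> 'a \<Rightarrow> real" where
  "max_fun f x = Max (range (\<lambda>i. f i x))"

definition phi :: "('n::finite \<Rightarrow> 'a \<Rightarrow> real) \<Rightarrow> 'a \<Rightarrow> real ^ 'n \<Rightarrow> real" where
  "phi f x y = (\<Sum>i\<in>UNIV. y $ i * f i x)"

definition active_set :: "('n::finite \<Rightarrow> 'a \<Rightarrow> real) \<Rightarrow> 'a \<Rightarrow> 'n set" where
  "active_set f x = {i. f i x = max_fun f x}"

definition saddle_point :: "('a \<Rightarrow> 'b \<Rightarrow> real) \<Rightarrow> 'a set \<Rightarrow> 'b set \<Rightarrow> 'a \<Rightarrow> 'b \<Rightarrow> bool" where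
  "saddle_point F X Y x' y' \<longleftrightarrow> x' \<in> X \<and> y' \<in> Y \<and>
     (\<forall>x\<in>X. \<forall>y\<in>Y. F x' y \<le> F x' y' \<and> F x' y' \<le> F x y')"

(* Meaningful only where such a D exists. On a finite-dimensional inner product space
   this is the case at every point of differentiability, by Riesz representation. *)
definition gradient :: "('a::real_inner \<Rightarrow> real) \<Rightarrow> 'a \<Rightarrow> 'a" where
  "gradient g x = (THE D. GDERIV g x :> D)"

lemma gradient_eqI:
  assumes "GDERIV g x :> D"
  shows "gradient g x = D"
  unfolding gradient_def
proof (rule the_equality)
  fix D' assume "GDERIV g x :> D'"
  then have "(\<lambda>h. inner h D') = (\<lambda>h. inner h D)"
    using assms unfolding gderiv_def by (rule has_derivative_unique)
  then have "\<forall>h. inner h D' = inner h D"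
    by (simp add: fun_eq_iff)
  then show "D' = D"
    using vector_eq_rdot[of D' D] by (simp add: inner_commute)
qed (rule assms)

(* The library's local_lipschitz concerns functions with an additional time parameter;
   this is the version without it. *)
definition locally_lipschitz :: "('a::metric_space \<Rightarrow> 'b::metric_space) \<Rightarrow> bool" where
  "locally_lipschitz g \<longleftrightarrow> (\<forall>x. \<exists>r>0. \<exists>L. L-lipschitz_on (ball x r) g)"

end

theory Submission
  imports Defs
begin

text \<open>
  Everything rests on the complementary slackness identity
  \<open>max_fun f x - phi f x y = (\<Sum>i. y $ i * (max_fun f x - f i x))\<close>, a sum of nonnegative terms when
  \<open>y\<close> is in the simplex. It gives \<open>phi f x y \<le> max_fun f x\<close>, with equality exactly when \<open>y\<close> is
  supported on the active set.

  A saddle point forces equality in this bound, since \<open>y\<close> may be compared with the vertices of the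
  simplex; then \<open>max_fun f x = phi f x y \<le> phi f z y \<le> max_fun f z\<close> for every \<open>z\<close>, so \<open>x\<close> is a
  minimizer. Stationarity together with equality gives a saddle point because a stationary point of
  the convex function \<open>\<lambda>z. phi f z y\<close> is a global minimum.

  The remaining implication, from a minimizer to a multiplier, is the substantial one
  (\<open>minimizer_imp_multiplier\<close>). Let \<open>v\<close> be the point of least norm in the convex hull of the active
  gradients. The variational inequality for \<open>v\<close> says \<open>v \<bullet> v \<le> g i \<bullet> v\<close> for every active gradient
  \<open>g i\<close>. If \<open>v\<close> were nonzero, \<open>- v\<close> would be a strict descent direction for all active functions at
  once, and a short step along it, too short for an inactive function to become active, would
  decrease the maximum. Hence \<open>v = 0\<close>, and the weights that represent \<open>v\<close> are the multiplier.

  Finite dimension provides the gradients, through the Riesz representation of the derivative.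
\<close>

section \<open>Existence of gradients\<close>

text \<open>
  Gram-Schmidt one vector at a time: representing the functional \<open>\<lambda>b. b \<bullet> a\<close> on the smaller span
  produces the orthogonal projection \<open>p\<close> of the new vector \<open>a\<close>, and the representing vector is then
  corrected along \<open>a - p\<close>, which does not disturb its values on the smaller span. Asking for
  \<open>D \<in> span B\<close> is what makes \<open>p\<close> a projection, and \<open>D\<close> orthogonal to \<open>a - p\<close>.
\<close>
lemma riesz_representation_span:
  fixes B :: "'a::real_inner set" and L :: "'a \<Rightarrow> real"
  assumes "finite B" and "linear L"
  shows "\<exists>D\<in>span B. \<forall>b\<in>span B. L b = b \<bullet> D"
  using assms
proof (induction B arbitrary: L rule: finite_induct)
  case empty
  then show ?case by (simp add: linear_0)
next
  case (insert a B)
  obtain p where p: "p \<in> span B" "\<And>b. b \<in> span B \<Longrightarrow> b \<bullet> a = b \<bullet> p"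
    using insert.IH[of "\<lambda>b. b \<bullet> a"] by (auto simp: bounded_linear.linear bounded_linear_inner_left)
  obtain D where D: "D \<in> span B" "\<And>b. b \<in> span B \<Longrightarrow> L b = b \<bullet> D"
    using insert.IH[of L] insert.prems by auto
  define u where "u = a - p"
  have orth: "b \<bullet> u = 0" if "b \<in> span B" for b
    using p(2)[OF that] by (simp add: u_def inner_diff_right)
  define D' where "D' = D + (L u / (u \<bullet> u)) *\<^sub>R u"
  have mono: "span B \<subseteq> span (insert a B)"
    by (intro span_mono) auto
  have u_span: "u \<in> span (insert a B)"
    unfolding u_def using p(1) mono by (intro span_diff) (auto intro: span_base)
  have "D' \<in> span (insert a B)"
    unfolding D'_def using D(1) mono u_span by (intro span_add span_scale) auto
  moreover have on_B: "L b = b \<bullet> D'" if "b \<in> span B" for b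
    using D(2)[OF that] orth[OF that] by (simp add: D'_def inner_add_right)
  \<comment> \<open>If \<open>a\<close> already lies in the span of \<open>B\<close>, then \<open>u = 0\<close> and the correction term in \<open>D'\<close> vanishes.\<close>
  have "L u = u \<bullet> D'"
  proof (cases "u = 0")
    case True
    then show ?thesis using insert.prems by (simp add: linear_0)
  next
    case False
    then show ?thesis
      using orth[OF D(1)] by (simp add: D'_def inner_add_right inner_commute)
  qed
  then have on_a: "L a = a \<bullet> D'"
    using on_B[OF p(1)] insert.prems by (simp add: u_def linear_diff inner_diff_left)
  have "L b = b \<bullet> D'" if "b \<in> span (insert a B)" for b
  proof (rule linear_eq_on_span[OF insert.prems _ _ that])
    show "linear (\<lambda>b. b \<bullet> D')"
      by (intro bounded_linear.linear bounded_linear_inner_left)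
  qed (use on_a on_B in \<open>auto intro: span_base\<close>)
  ultimately show ?case by blast
qed

lemma GDERIV_gradient:
  fixes g :: "'a::real_inner \<Rightarrow> real"
  assumes "\<exists>B :: 'a set. finite B \<and> span B = UNIV" and "g differentiable (at x)"
  shows "GDERIV g x :> gradient g x"
proof -
  obtain L where L: "(g has_derivative L) (at x)"
    using assms(2) unfolding differentiable_def by blast
  obtain D where D: "\<And>b. L b = b \<bullet> D"
    using assms(1) riesz_representation_span[OF _ has_derivative_linear[OF L]] by (metis UNIV_I)
  have "L = (\<lambda>b. b \<bullet> D)" using D by (rule ext)
  then have "GDERIV g x :> D"
    using L by (simp add: gderiv_def)
  then show ?thesis
    using gradient_eqI by metis
qed

lemma GDERIV_phi:
  fixes f :: "'n::finite \<Rightarrow> 'a::real_inner \<Rightarrow> real"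
  assumes "\<And>i. GDERIV (f i) x :> g i"
  shows "GDERIV (\<lambda>x. phi f x y) x :> (\<Sum>i\<in>UNIV. y $ i *\<^sub>R g i)"
  unfolding gderiv_def phi_def inner_sum_right inner_scaleR_right
  using assms[unfolded gderiv_def] by (intro has_derivative_sum has_derivative_mult_right) auto

section \<open>Stationary points of convex functions\<close>

lemma GDERIV_along_line:
  fixes g :: "'a::real_inner \<Rightarrow> real"
  assumes "GDERIV g x :> D"
  shows "DERIV (\<lambda>t. g (x + t *\<^sub>R d)) 0 :> d \<bullet> D"
proof -
  have "((\<lambda>t. x + t *\<^sub>R d) has_derivative (\<lambda>t. t *\<^sub>R d)) (at 0)"
    by (auto intro!: derivative_eq_intros)
  moreover have "(g has_derivative (\<lambda>h. h \<bullet> D)) (at (x + 0 *\<^sub>R d))"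
    using assms by (simp add: gderiv_def)
  ultimately have "((\<lambda>t. g (x + t *\<^sub>R d)) has_derivative (\<lambda>t. (t *\<^sub>R d) \<bullet> D)) (at 0)"
    by (rule has_derivative_compose)
  then show ?thesis
    by (rule has_derivative_imp_has_field_derivative) simp
qed

text \<open>
  Restricted to the line through \<open>x\<close> and \<open>z\<close>, the function is convex on the reals and lies above
  its tangent at \<open>x\<close>, which is horizontal.
\<close>
lemma convex_stationary_imp_minimum:
  fixes g :: "'a::real_inner \<Rightarrow> real"
  assumes "convex_on UNIV g" and "GDERIV g x :> 0"
  shows "g x \<le> g z"
proof -
  let ?h = "\<lambda>t::real. g (x + t *\<^sub>R (z - x))"
  have "convex_on UNIV ?h"
  proof (rule convex_onI)
    fix t r s :: real assume t: "0 < t" "t < 1"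
    have "x + ((1 - t) *\<^sub>R r + t *\<^sub>R s) *\<^sub>R (z - x) =
        (1 - t) *\<^sub>R (x + r *\<^sub>R (z - x)) + t *\<^sub>R (x + s *\<^sub>R (z - x))"
      by (simp add: algebra_simps)
    then show "?h ((1 - t) *\<^sub>R r + t *\<^sub>R s) \<le> (1 - t) * ?h r + t * ?h s"
      using convex_onD[OF assms(1), of t "x + r *\<^sub>R (z - x)" "x + s *\<^sub>R (z - x)"] t by simp
  qed simp
  then have "?h 1 - ?h 0 \<ge> 0 * (1 - 0)"
    using GDERIV_along_line[OF assms(2), of "z - x"]
    by (intro convex_on_imp_above_tangent[where A = UNIV]) auto
  then show ?thesis by simp
qed

lemma convex_on_phi:
  fixes f :: "'n::finite \<Rightarrow> 'a::real_vector \<Rightarrow> real"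
  assumes "\<And>i. convex_on UNIV (f i)" and "y \<in> prob_simplex"
  shows "convex_on UNIV (\<lambda>x. phi f x y)"
proof -
  have "convex_on UNIV (\<lambda>x. \<Sum>i\<in>S. y $ i * f i x)" if "finite S" for S
    using that
  proof (induction S rule: finite_induct)
    case (insert i S)
    then show ?case
      using assms by (auto simp: prob_simplex_def intro!: convex_on_add convex_on_cmul)
  qed (simp add: convex_on_const)
  then show ?thesis by (simp add: phi_def)
qed

section \<open>The maximum and its complementary slackness identity\<close>

lemma le_max_fun: "f i x \<le> max_fun f x"
  by (simp add: max_fun_def)

lemma max_fun_less_iff: "max_fun f x < c \<longleftrightarrow> (\<forall>i. f i x < c)"
  by (simp add: max_fun_def)

lemma active_set_nonempty: "active_set f x \<noteq> {}"
proof -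
  have "max_fun f x \<in> range (\<lambda>i. f i x)"
    unfolding max_fun_def by (intro Max_in) auto
  then show ?thesis by (auto simp: active_set_def)
qed

text \<open>
  The slackness identity: because the weights add up to one, the gap between the maximum and the
  average is the average of the individual gaps, each of which is nonnegative.
\<close>
lemma max_fun_minus_phi:
  assumes "y \<in> prob_simplex"
  shows "max_fun f x - phi f x y = (\<Sum>i\<in>UNIV. y $ i * (max_fun f x - f i x))"
  using assms
  by (simp add: prob_simplex_def phi_def right_diff_distrib sum_subtractf flip: sum_distrib_right)

lemma phi_le_max_fun:
  assumes "y \<in> prob_simplex"
  shows "phi f x y \<le> max_fun f x"
proof -
  have "0 \<le> (\<Sum>i\<in>UNIV. y $ i * (max_fun f x - f i x))"
    using assms by (intro sum_nonneg) (simp add: prob_simplex_def le_max_fun)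
  then show ?thesis using max_fun_minus_phi[OF assms, of f x] by simp
qed

lemma phi_eq_max_fun_iff:
  assumes "y \<in> prob_simplex"
  shows "max_fun f x = phi f x y \<longleftrightarrow> (\<forall>i. y $ i > 0 \<longrightarrow> i \<in> active_set f x)"
proof -
  have "max_fun f x = phi f x y \<longleftrightarrow> (\<Sum>i\<in>UNIV. y $ i * (max_fun f x - f i x)) = 0"
    using max_fun_minus_phi[OF assms, of f x] by auto
  also have "\<dots> \<longleftrightarrow> (\<forall>i. y $ i * (max_fun f x - f i x) = 0)"
    using assms by (subst sum_nonneg_eq_0_iff) (auto simp: prob_simplex_def le_max_fun)
  also have "\<dots> \<longleftrightarrow> (\<forall>i. y $ i > 0 \<longrightarrow> i \<in> active_set f x)"
    using assms by (auto simp: prob_simplex_def active_set_def less_le)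
  finally show ?thesis .
qed

section \<open>Saddle points\<close>

lemma axis_in_prob_simplex: "axis i 1 \<in> prob_simplex"
  by (simp add: prob_simplex_def axis_def)

lemma phi_axis: "phi f x (axis i 1) = f i x"
  by (simp add: phi_def axis_def if_distrib[of "\<lambda>c. c * _"] cong: if_cong)

text \<open>
  The vertex of the simplex at an active index \<open>i\<close> makes \<open>phi\<close> equal to \<open>f i x\<close>, hence to the
  maximum, so maximality of \<open>y\<close> closes the gap.
\<close>
lemma saddle_point_imp_phi_eq_max_fun:
  assumes "saddle_point (phi f) UNIV prob_simplex x y"
  shows "max_fun f x = phi f x y"
proof (rule antisym)
  obtain i where "i \<in> active_set f x"
    using active_set_nonempty[of f x] by blast
  then show "max_fun f x \<le> phi f x y"
    using assms axis_in_prob_simplex[of i] phi_axis[of f x i]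
    unfolding saddle_point_def active_set_def by fastforce
  show "phi f x y \<le> max_fun f x"
    using assms by (simp add: saddle_point_def phi_le_max_fun)
qed

lemma saddle_point_imp_minimizer:
  assumes "saddle_point (phi f) UNIV prob_simplex x y"
  shows "is_arg_min (max_fun f) (\<lambda>_. True) x"
  unfolding is_arg_min_linorder
proof (intro conjI allI impI)
  fix z
  have y: "y \<in> prob_simplex" "phi f x y \<le> phi f z y"
    using assms unfolding saddle_point_def by auto
  then show "max_fun f x \<le> max_fun f z"
    using saddle_point_imp_phi_eq_max_fun[OF assms] phi_le_max_fun[OF y(1), of f z] by linarith
qed simp

lemma stationary_imp_saddle_point:
  fixes f :: "'n::finite \<Rightarrow> 'a::real_inner \<Rightarrow> real"
  assumes "\<And>i. convex_on UNIV (f i)" and y: "y \<in> prob_simplex"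
    and "GDERIV (\<lambda>x. phi f x y) x :> 0" and "max_fun f x = phi f x y"
  shows "saddle_point (phi f) UNIV prob_simplex x y"
  using assms phi_le_max_fun[of _ f x]
    convex_stationary_imp_minimum[OF convex_on_phi[OF assms(1) y] assms(3)]
  by (auto simp: saddle_point_def)

section \<open>Existence of a multiplier at a minimizer\<close>

lemma convex_prob_simplex_face:
  "convex {y \<in> prob_simplex. \<forall>i. i \<notin> A \<longrightarrow> y $ i = 0}"
  unfolding convex_def prob_simplex_def
  by (auto simp: sum.distrib simp flip: sum_distrib_left)

text \<open>
  The inequality is the obtuse angle criterion for the projection of the origin onto the convex hull
  of \<open>g ` A\<close>. That hull is compact as the hull of a finite set, so the projection exists in any inner
  product space.
\<close>
lemma min_norm_convex_combination:
  fixes g :: "'n::finite \<Rightarrow> 'a::real_inner"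
  assumes "A \<noteq> {}"
  obtains y where "y \<in> prob_simplex" and "\<And>i. i \<notin> A \<Longrightarrow> y $ i = 0"
    and "\<And>j. j \<in> A \<Longrightarrow>
      (\<Sum>i\<in>UNIV. y $ i *\<^sub>R g i) \<bullet> (\<Sum>i\<in>UNIV. y $ i *\<^sub>R g i)
        \<le> g j \<bullet> (\<Sum>i\<in>UNIV. y $ i *\<^sub>R g i)"
proof -
  \<comment> \<open>Weights are indexed by \<open>A\<close> while \<open>g\<close> need not be injective; viewing \<open>g ` A\<close> as the image of
    simplex vertices under a linear map recovers weights on indices.\<close>
  define h where "h = (\<lambda>y::real^'n. \<Sum>i\<in>UNIV. y $ i *\<^sub>R g i)"
  define T where "T = (\<lambda>i::'n. axis i (1::real)) ` A"
  have lin: "linear h"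
    unfolding h_def by (intro linear_compose_sum ballI)
      (simp add: linear_iff scaleR_add_left)
  have h_axis: "h (axis i 1) = g i" for i
    by (simp add: h_def axis_def if_distrib[of "\<lambda>c. c *\<^sub>R _"] cong: if_cong)
  have hull: "convex hull (g ` A) = h ` (convex hull T)"
    using convex_hull_linear_image[OF lin, of T] by (simp add: T_def image_image h_axis)
  have compact: "compact (convex hull (g ` A))"
    by (intro finite_imp_compact_convex_hull) simp
  obtain v where v: "v \<in> convex hull (g ` A)"
      "\<forall>z\<in>convex hull (g ` A). dist 0 v \<le> dist 0 z"
    using continuous_attains_inf[OF compact _
        continuous_on_dist[OF continuous_on_const continuous_on_id], of 0] assms by auto
  then obtain y where y: "y \<in> convex hull T" "v = h y"
    using hull by auto
  have "convex hull T \<subseteq> {y \<in> prob_simplex. \<forall>i. i \<notin> A \<longrightarrow> y $ i = 0}"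
    by (intro hull_minimal convex_prob_simplex_face)
      (auto simp: T_def axis_in_prob_simplex, auto simp: axis_def)
  then have "y \<in> prob_simplex" "\<And>i. i \<notin> A \<Longrightarrow> y $ i = 0"
    using y(1) by auto
  moreover have "v \<bullet> v \<le> g j \<bullet> v" if "j \<in> A" for j
  proof -
    have "(0 - v) \<bullet> (g j - v) \<le> 0"
      using v that compact
      by (intro any_closest_point_dot[of "convex hull (g ` A)"])
        (auto simp: compact_imp_closed hull_inc)
    then show ?thesis by (simp add: inner_diff_right inner_commute)
  qed
  ultimately show ?thesis
    using that y(2) unfolding h_def by blast
qed

text \<open>
  For small positive steps the active functions decrease to first order, and the inactive ones stay
  below the maximum by continuity. There are finitely many functions, so one step length serves all.
\<close>
lemma descent_on_active_set_decreases_max_fun: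
  fixes f :: "'n::finite \<Rightarrow> 'a::real_inner \<Rightarrow> real"
  assumes deriv: "\<And>i. GDERIV (f i) x :> g i"
    and descent: "\<And>i. i \<in> active_set f x \<Longrightarrow> d \<bullet> g i < 0"
  shows "\<exists>z. max_fun f z < max_fun f x"
proof -
  have "\<forall>\<^sub>F t in at_right 0. f i (x + t *\<^sub>R d) < max_fun f x" for i
  proof (cases "i \<in> active_set f x")
    case True
    obtain e where "0 < e" "\<And>t. 0 < t \<Longrightarrow> t < e \<Longrightarrow> f i (x + (0 + t) *\<^sub>R d) < f i (x + 0 *\<^sub>R d)"
      using DERIV_neg_dec_right[OF GDERIV_along_line[OF deriv[of i]] descent[OF True]] by blast
    then show ?thesis
      using True unfolding eventually_at_right_field active_set_def by auto
  next
    case False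
    then have "f i (x + 0 *\<^sub>R d) < max_fun f x"
      using le_max_fun[of f i x] by (simp add: active_set_def)
    moreover have "((\<lambda>t. f i (x + t *\<^sub>R d)) \<longlongrightarrow> f i (x + 0 *\<^sub>R d)) (at_right 0)"
      using DERIV_isCont[OF GDERIV_along_line[OF deriv[of i], of d]]
      by (auto simp: isCont_def intro: tendsto_mono[OF at_le])
    ultimately show ?thesis by (rule order_tendstoD(2)[rotated])
  qed
  then have "\<forall>\<^sub>F t in at_right 0. \<forall>i. f i (x + t *\<^sub>R d) < max_fun f x"
    by (rule eventually_all_finite)
  then have "\<exists>t. \<forall>i. f i (x + t *\<^sub>R d) < max_fun f x"
    by (intro eventually_happens'[OF trivial_limit_at_right_real])
  then show ?thesis by (auto simp: max_fun_less_iff)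
qed

lemma minimizer_imp_multiplier:
  fixes f :: "'n::finite \<Rightarrow> 'a::real_inner \<Rightarrow> real"
  assumes deriv: "\<And>i. GDERIV (f i) x :> g i"
    and min: "is_arg_min (max_fun f) (\<lambda>_. True) x"
  obtains y where "y \<in> prob_simplex" and "(\<Sum>i\<in>UNIV. y $ i *\<^sub>R g i) = 0"
    and "max_fun f x = phi f x y"
proof -
  obtain y where y: "y \<in> prob_simplex" "\<And>i. i \<notin> active_set f x \<Longrightarrow> y $ i = 0"
    and norm_le: "\<And>j. j \<in> active_set f x \<Longrightarrow>
      (\<Sum>i\<in>UNIV. y $ i *\<^sub>R g i) \<bullet> (\<Sum>i\<in>UNIV. y $ i *\<^sub>R g i)
        \<le> g j \<bullet> (\<Sum>i\<in>UNIV. y $ i *\<^sub>R g i)"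
    using min_norm_convex_combination[OF active_set_nonempty[of f x], of g] by blast
  define v where "v = (\<Sum>i\<in>UNIV. y $ i *\<^sub>R g i)"
  have "v = 0"
  proof (rule ccontr)
    assume "v \<noteq> 0"
    have "(- v) \<bullet> g i < 0" if "i \<in> active_set f x" for i
    proof -
      have "0 < v \<bullet> v" using \<open>v \<noteq> 0\<close> by simp
      also have "\<dots> \<le> g i \<bullet> v" using norm_le[OF that] by (simp add: v_def)
      finally show ?thesis by (simp add: inner_commute)
    qed
    then show False
      using descent_on_active_set_decreases_max_fun[of f x g "- v"] deriv min
      unfolding is_arg_min_def by blast
  qed
  moreover have "max_fun f x = phi f x y"
    using y by (metis phi_eq_max_fun_iff less_irrefl)
  ultimately show ?thesis using that y(1) by (simp add: v_def)
qed

section \<open>Optimality conditions for the maximum\<close>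

theorem theorem3p1:
  fixes f :: "'n::finite \<Rightarrow> 'a::real_inner \<Rightarrow> real" and x' :: 'a
  assumes finite_dim: "\<exists>B :: 'a set. finite B \<and> span B = UNIV"
    and convex: "\<And>i. convex_on UNIV (f i)"
    and differentiable: "\<And>i x. f i differentiable (at x)"
    and gradient_lipschitz: "\<And>i. locally_lipschitz (gradient (f i))"
  shows
    "(is_arg_min (max_fun f) (\<lambda>_. True) x' \<longleftrightarrow>
        (\<exists>y'\<in>prob_simplex. gradient (\<lambda>x. phi f x y') x' = 0 \<and> max_fun f x' = phi f x' y'))
     \<and> (is_arg_min (max_fun f) (\<lambda>_. True) x' \<longleftrightarrow>
        (\<exists>y'\<in>prob_simplex. saddle_point (phi f) UNIV prob_simplex x' y'))
     \<and> (\<forall>y'\<in>prob_simplex.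
          (gradient (\<lambda>x. phi f x y') x' = 0 \<and> max_fun f x' = phi f x' y')
            \<or> saddle_point (phi f) UNIV prob_simplex x' y'
          \<longrightarrow> (\<forall>i. y' $ i > 0 \<longrightarrow> i \<in> active_set f x'))"
proof -
  let ?a = "is_arg_min (max_fun f) (\<lambda>_. True) x'"
  let ?b = "\<lambda>y. gradient (\<lambda>x. phi f x y) x' = 0 \<and> max_fun f x' = phi f x' y"
  let ?c = "\<lambda>y. saddle_point (phi f) UNIV prob_simplex x' y"
  have deriv: "GDERIV (f i) x' :> gradient (f i) x'" for i
    by (rule GDERIV_gradient[OF finite_dim differentiable])
  have deriv_phi: "GDERIV (\<lambda>x. phi f x y) x' :> (\<Sum>i\<in>UNIV. y $ i *\<^sub>R gradient (f i) x')" for y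
    by (rule GDERIV_phi[OF deriv])
  have ab: "\<exists>y\<in>prob_simplex. ?b y" if ?a
    using minimizer_imp_multiplier[OF deriv that] gradient_eqI[OF deriv_phi] by metis
  have bc: "?c y" if "y \<in> prob_simplex" "?b y" for y
    using that deriv_phi[of y] gradient_eqI[OF deriv_phi[of y]]
    by (intro stationary_imp_saddle_point convex) auto
  have ca: ?a if "?c y" for y
    using that by (rule saddle_point_imp_minimizer)
  have "\<forall>i. y $ i > 0 \<longrightarrow> i \<in> active_set f x'" if "y \<in> prob_simplex" "?b y \<or> ?c y" for y
    using that saddle_point_imp_phi_eq_max_fun[of f x' y] by (auto simp flip: phi_eq_max_fun_iff)
  with ab bc ca show ?thesis by blast
qed

end
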